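(* Let $\eta\geq 3$ be an odd integer that is not a perfect square, and let $c$ and $m$ be positive integers. Let $\phi$ be the Euler phi-function and $\varphi(\eta)=\{\xi\in\mathbb{Z}:\gcd(\xi,\eta)=1,\ 1\leq \xi<\eta\}$. Define $\zeta_\eta^5:\{\xi\in\mathbb{Z}:\gcd(\xi,\eta)=1\}\to\{0,1\}$ by $\zeta_\eta^5(a)=\frac{1+(a/\eta)}{2}$, where $(a/\eta)$ is the Jacobi symbol, and let $$S=\{c\eta\}\cup\left(\bigcup_{j=0}^{m-1}\{i+j\eta:i\in\varphi(\eta)\}\right).$$ Then the star graph $\mathrm{Star}_{m\phi(\eta)+1}$ is an arithmetic cordial graph modulo $\eta$ under $\langle S,\zeta_\eta^5,+\rangle$, where $+$ is ordinary addition of integers.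
   Context: Star graph: $\mathrm{Star}_n$ is the simple graph with $n$ vertices $x_0,v_1,\ldots,v_{n-1}$ in which $x_0$ is adjacent to each $v_i$ and there are no other edges. Arithmetic cordial graph: let $\eta$ be a positive integer, $S\subseteq\mathbb{Z}$, $\star:S\times S\to\mathbb{Z}$ a binary function, and $\zeta_\eta:\{\xi\in\mathbb{Z}:\gcd(\xi,\eta)=1\}\to\{0,1\}$ a function. The triple $\langle S,\zeta_\eta,\star\rangle$ is called an arithmetic structure. For a simple connected graph $G$ of order $n$, a bijection $f:V(G)\to S$ (where $|S|=n$) is an arithmetic cordial labeling modulo $\eta$ under $\langle S,\zeta_\eta,\star\rangle$ if the induced function $f_\eta^*:E(G)\to\{0,1\}$, defined by $f_\eta^*(ab)=0$ if $\gcd(f(a)\star f(b),\eta)\neq 1$ or $\zeta_\eta(f(a)\star f(b))=0$, and $f_\eta^*(ab)=1$ if $\gcd(f(a)\star f(b),\eta)=1$ and $\zeta_\eta(f(a)\star f(b))=1$, satisfies $|e_{f_\eta^*}(0)-e_{f_\eta^*}(1)|\leq 1$, where $e_{f_\eta^*}(i)$ is the number of edges with label $i$. A graph admitting such a labeling is an arithmetic cordial graph modulo $\eta$ under $\langle S,\zeta_\eta,\star\rangle$. *)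

theory Defs
  imports "HOL-Number_Theory.Number_Theory" "HOL-Computational_Algebra.Nth_Powers"
begin

type_synonym 'a ugraph = "'a set \<times> 'a set set"

definition simple_graph :: "'a ugraph \<Rightarrow> bool" where
  "simple_graph G \<longleftrightarrow>
     finite (fst G) \<and> (\<forall>e \<in> snd G. \<exists>a b. a \<in> fst G \<and> b \<in> fst G \<and> a \<noteq> b \<and> e = {a, b})"

definition connected_graph :: "'a ugraph \<Rightarrow> bool" where
  "connected_graph G \<longleftrightarrow>
     fst G \<noteq> {} \<and> (\<forall>u \<in> fst G. \<forall>v \<in> fst G. (u, v) \<in> {(a, b). {a, b} \<in> snd G}\<^sup>*)"

(* The vertex 0 is the centre x_0, and the vertex i (with 1 \<le> i < n) is v_i. *)
definition star_graph :: "nat \<Rightarrow> nat ugraph" where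
  "star_graph n = ({..<n}, {{0, i} | i. 1 \<le> i \<and> i < n})"

(* A map S \<times> S -> \<int> and a map on the integers coprime to \<eta> are represented by total functions
   whose values elsewhere are never used; what remains to be required is that \<zeta> takes
   values in {0, 1}. *)
definition arithmetic_structure ::
  "nat \<Rightarrow> int set \<Rightarrow> (int \<Rightarrow> int) \<Rightarrow> (int \<Rightarrow> int \<Rightarrow> int) \<Rightarrow> bool" where
  "arithmetic_structure \<eta> S \<zeta> star \<longleftrightarrow>
     \<eta> > 0 \<and> (\<forall>\<xi>. gcd \<xi> (int \<eta>) = 1 \<longrightarrow> \<zeta> \<xi> \<in> {0, 1})"

definition label_value :: "nat \<Rightarrow> (int \<Rightarrow> int) \<Rightarrow> int \<Rightarrow> int" where
  "label_value \<eta> \<zeta> x = (if gcd x (int \<eta>) \<noteq> 1 \<or> \<zeta> x = 0 then 0 else 1)"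

(* Edges are unordered, and every ordered pair (a, b) of adjacent vertices is constrained:
   if star is not commutative, such a g exists only when the label of each edge is
   independent of the order of its endpoints. On the edges g is unique. *)
definition induced_edge_labeling ::
  "'a ugraph \<Rightarrow> nat \<Rightarrow> (int \<Rightarrow> int) \<Rightarrow> (int \<Rightarrow> int \<Rightarrow> int) \<Rightarrow> ('a \<Rightarrow> int) \<Rightarrow> ('a set \<Rightarrow> int) \<Rightarrow> bool" where
  "induced_edge_labeling G \<eta> \<zeta> star f g \<longleftrightarrow>
     (\<forall>a b. {a, b} \<in> snd G \<longrightarrow> g {a, b} = label_value \<eta> \<zeta> (star (f a) (f b)))"

definition edge_count :: "'a ugraph \<Rightarrow> ('a set \<Rightarrow> int) \<Rightarrow> int \<Rightarrow> nat" where
  "edge_count G g i = card {e \<in> snd G. g e = i}"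

definition arithmetic_cordial_labeling ::
  "'a ugraph \<Rightarrow> nat \<Rightarrow> int set \<Rightarrow> (int \<Rightarrow> int) \<Rightarrow> (int \<Rightarrow> int \<Rightarrow> int) \<Rightarrow> ('a \<Rightarrow> int) \<Rightarrow> bool" where
  "arithmetic_cordial_labeling G \<eta> S \<zeta> star f \<longleftrightarrow>
     bij_betw f (fst G) S \<and>
     (\<exists>g. induced_edge_labeling G \<eta> \<zeta> star f g \<and>
          \<bar>int (edge_count G g 0) - int (edge_count G g 1)\<bar> \<le> 1)"

definition arithmetic_cordial_graph ::
  "'a ugraph \<Rightarrow> nat \<Rightarrow> int set \<Rightarrow> (int \<Rightarrow> int) \<Rightarrow> (int \<Rightarrow> int \<Rightarrow> int) \<Rightarrow> bool" where
  "arithmetic_cordial_graph G \<eta> S \<zeta> star \<longleftrightarrow>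
     simple_graph G \<and> connected_graph G \<and> arithmetic_structure \<eta> S \<zeta> star \<and>
     (\<exists>f. arithmetic_cordial_labeling G \<eta> S \<zeta> star f)"

(* The Jacobi symbol, meaningful for odd positive n: the product of Legendre symbols
   over the prime factors of n, with multiplicity. *)
definition Jacobi :: "int \<Rightarrow> nat \<Rightarrow> int" where
  "Jacobi a n = (\<Prod>p \<in># prime_factorization n. Legendre a (int p))"

(* The division is exact for a coprime to \<eta>, where the Jacobi symbol is 1 or -1. *)
definition zeta5 :: "nat \<Rightarrow> int \<Rightarrow> int" where
  "zeta5 \<eta> a = (1 + Jacobi a \<eta>) div 2"

definition reduced_residues :: "nat \<Rightarrow> int set" where
  "reduced_residues \<eta> = {\<xi>. gcd \<xi> (int \<eta>) = 1 \<and> 1 \<le> \<xi> \<and> \<xi> < int \<eta>}"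

end

theory Submission imports Defs begin

text \<open>
  Put the multiple \<open>c * \<eta>\<close> of the modulus at the centre of the star and the other elements of
  \<open>S\<close> at the leaves. The sum on the edge to the leaf \<open>i + j * \<eta>\<close> is then congruent to \<open>i\<close>
  modulo \<open>\<eta>\<close>, and the Jacobi symbol over \<open>\<eta>\<close> depends only on residue classes, so the edge gets
  label 1 if the symbol of \<open>i\<close> is 1, and label 0 if it is -1. Each \<open>i\<close> in
  \<open>reduced_residues \<eta>\<close> occurs \<open>m\<close> times, so the labels balance (exactly, not merely up to
  one) as soon as the symbol takes the values 1 and -1 equally often on the reduced residues.

  That is the statement that a nontrivial real character sums to zero. As \<open>\<eta>\<close> is not a square,
  some prime \<open>p\<close> divides it to an odd power, and the Chinese remainder theorem gives a \<open>b\<close> that is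
  a non-residue modulo \<open>p\<close> and congruent to 1 modulo the part of \<open>\<eta>\<close> coprime to \<open>p\<close>; its
  Jacobi symbol is -1 (lemma \<open>exists_Jacobi_minus_one\<close>). Multiplication by \<open>b\<close> permutes the
  reduced residues and changes the sign of the symbol, because the symbol is multiplicative
  (lemma \<open>Jacobi_balanced\<close>).
\<close>

section \<open>The Legendre and Jacobi symbols\<close>

lemma Legendre_cong:
  assumes "[a = b] (mod p)"
  shows "Legendre a p = Legendre b p"
proof -
  have "[a = 0] (mod p) \<longleftrightarrow> [b = 0] (mod p)"
    using assms cong_sym cong_trans by blast
  moreover have "QuadRes p a \<longleftrightarrow> QuadRes p b"
    unfolding QuadRes_def using assms cong_sym cong_trans by blast
  ultimately show ?thesis
    by (simp add: Legendre_def)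
qed

text \<open>
  Euler's criterion gives the identity modulo \<open>p\<close>. Both sides lie between -1 and 1, so for
  \<open>p > 2\<close> congruence forces equality.
\<close>

lemma Legendre_mult:
  assumes "prime p" "2 < p"
  shows "Legendre (a * b) (int p) = Legendre a (int p) * Legendre b (int p)"
proof -
  let ?k = "(p - 1) div 2"
  have "[Legendre a p * Legendre b p = a ^ ?k * b ^ ?k] (mod p)"
    using assms by (intro cong_mult euler_criterion)
  moreover have "[Legendre (a * b) p = a ^ ?k * b ^ ?k] (mod p)"
    using euler_criterion[OF assms, of "a * b"] by (simp add: power_mult_distrib)
  ultimately have "[Legendre (a * b) p = Legendre a p * Legendre b p] (mod p)"
    using cong_sym cong_trans by blast
  hence "int p dvd Legendre (a * b) p - Legendre a p * Legendre b p"
    by (simp add: cong_iff_dvd_diff)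
  moreover have "\<bar>Legendre (a * b) p - Legendre a p * Legendre b p\<bar> < int p"
    using assms(2) by (auto simp: Legendre_def)
  ultimately show ?thesis
    by (metis dvd_imp_le_int eq_iff_diff_eq_0 linorder_not_le abs_of_nat)
qed

lemma Jacobi_cong:
  assumes "n > 0" "[a = b] (mod int n)"
  shows "Jacobi a n = Jacobi b n"
proof -
  have "Legendre a (int p) = Legendre b (int p)" if "p \<in># prime_factorization n" for p
    using assms that by (intro Legendre_cong) (auto dest!: in_prime_factors_imp_dvd intro: cong_dvd_modulus)
  thus ?thesis
    unfolding Jacobi_def by (metis (mono_tags, lifting) image_mset_cong)
qed

lemma Jacobi_mult:
  assumes "odd n"
  shows "Jacobi (a * b) n = Jacobi a n * Jacobi b n"
proof -
  have "Legendre (a * b) (int p) = Legendre a (int p) * Legendre b (int p)"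
    if "p \<in># prime_factorization n" for p
  proof (rule Legendre_mult)
    show "prime p" using that by auto
    have "p \<noteq> 2" using that assms by (auto dest!: in_prime_factors_imp_dvd)
    thus "2 < p" using prime_ge_2_nat[OF \<open>prime p\<close>] by linarith
  qed
  hence "Jacobi (a * b) n =
      (\<Prod>p \<in># prime_factorization n. Legendre a (int p) * Legendre b (int p))"
    unfolding Jacobi_def by (metis (mono_tags, lifting) image_mset_cong)
  thus ?thesis
    by (simp add: Jacobi_def prod_mset.distrib)
qed

lemma Jacobi_one: "Jacobi 1 n = 1"
proof -
  have "Legendre 1 (int p) = 1" if "p \<in># prime_factorization n" for p
  proof -
    have "QuadRes (int p) 1"
      unfolding QuadRes_def by (rule exI[of _ 1]) simp
    moreover have "\<not> [1 = 0] (mod int p)"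
      using that prime_gt_1_nat[of p] by (auto simp: cong_iff_dvd_diff)
    ultimately show ?thesis by (simp add: Legendre_def)
  qed
  hence "Jacobi 1 n = (\<Prod>p \<in># prime_factorization n. 1)"
    unfolding Jacobi_def by (metis (mono_tags, lifting) image_mset_cong)
  thus ?thesis by simp
qed

lemma Jacobi_prime: "prime p \<Longrightarrow> Jacobi a p = Legendre a (int p)"
  by (simp add: Jacobi_def prime_factorization_prime)

lemma Jacobi_mult_right:
  assumes "n > 0" "k > 0"
  shows "Jacobi a (n * k) = Jacobi a n * Jacobi a k"
  using assms by (simp add: Jacobi_def prime_factorization_mult)

lemma Jacobi_power_right:
  assumes "n > 0"
  shows "Jacobi a (n ^ k) = Jacobi a n ^ k"
proof (induction k)
  case 0
  show ?case by (simp add: Jacobi_def)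
next
  case (Suc k)
  thus ?case using assms by (simp add: Jacobi_mult_right)
qed

lemma Jacobi_coprime:
  assumes "n > 0" "coprime a (int n)"
  shows "Jacobi a n \<in> {-1, 1}"
proof -
  have "Legendre a (int p) \<in> {-1, 1}" if "p \<in># prime_factorization n" for p
  proof -
    have "\<not> int p dvd a"
    proof
      assume "int p dvd a"
      moreover have "int p dvd int n" using that by auto
      ultimately have "is_unit (int p)" using assms(2) by (meson coprime_common_divisor)
      hence "p = 1" by simp
      moreover have "prime p" using that by auto
      ultimately show False by simp
    qed
    thus ?thesis by (auto simp: Legendre_def cong_0_iff)
  qed
  moreover have "(\<Prod>p \<in># M. Legendre a (int p)) \<in> {-1, 1}"
    if "\<forall>p \<in># M. Legendre a (int p) \<in> {-1, 1}" for M
    using that by (induction M) auto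
  ultimately show ?thesis
    unfolding Jacobi_def by blast
qed

section \<open>Equidistribution of the Jacobi symbol\<close>

text \<open>
  Squaring maps the residues modulo \<open>p\<close> to themselves but identifies 1 with \<open>p - 1\<close>; an
  endofunction of a finite set that is not injective misses some value.
\<close>

lemma exists_Legendre_minus_one:
  assumes "prime p" "2 < p"
  shows "\<exists>a. Legendre a (int p) = -1"
proof -
  let ?R = "{0..<int p}"
  let ?sq = "\<lambda>y. y^2 mod int p"
  have "?sq 1 = ?sq (int p - 1)"
  proof -
    have "(int p - 1)^2 = 1 + (int p - 2) * int p"
      by (simp add: power2_eq_square algebra_simps)
    thus ?thesis by (metis mod_mult_self1 one_power2)
  qed
  moreover have "1 \<in> ?R" "int p - 1 \<in> ?R" "(1::int) \<noteq> int p - 1"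
    using assms(2) by auto
  ultimately have "\<not> inj_on ?sq ?R"
    unfolding inj_on_def by blast
  moreover have "?sq ` ?R \<subseteq> ?R"
    using assms(2) by auto
  ultimately have "?sq ` ?R \<noteq> ?R"
    using finite_surj_inj[of ?R ?sq] by auto
  with \<open>?sq ` ?R \<subseteq> ?R\<close> obtain a where a: "a \<in> ?R" "a \<notin> ?sq ` ?R"
    by blast
  have "\<not> QuadRes (int p) a"
  proof
    assume "QuadRes (int p) a"
    then obtain y where "[y^2 = a] (mod int p)"
      unfolding QuadRes_def by blast
    hence "?sq (y mod int p) = a"
      using a(1) by (simp add: cong_def power_mod)
    moreover have "y mod int p \<in> ?R"
      using assms(2) by simp
    ultimately show False using a(2) by blast
  qed
  moreover have "a \<noteq> 0"
  proof
    assume "a = 0"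
    hence "a = ?sq 0" by simp
    moreover have "0 \<in> ?R" using assms(2) by simp
    ultimately show False using a(2) by blast
  qed
  hence "\<not> [a = 0] (mod int p)"
    using a(1) by (auto simp: cong_def)
  ultimately show ?thesis
    by (auto simp: Legendre_def)
qed

text \<open>
  Only a prime of odd multiplicity can make the symbol of \<open>b\<close> negative, and being a square means
  having no such prime.
\<close>

lemma exists_Jacobi_minus_one:
  fixes n :: nat
  assumes "odd n" "\<not> is_square n"
  shows "\<exists>b. coprime b (int n) \<and> Jacobi b n = -1"
proof -
  obtain p where p: "prime p" "odd (multiplicity p n)"
    using assms(2) is_nth_power_conv_multiplicity_nat[of 2 n] by auto
  define k where "k = multiplicity p n"
  have "n \<noteq> 0" using assms(1) by (cases "n = 0") auto
  have "\<not> is_unit p" using p(1) by auto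
  then obtain r where r: "n = p ^ k * r" "\<not> p dvd r"
    unfolding k_def using multiplicity_decompose'[OF \<open>n \<noteq> 0\<close>] by blast
  have "odd k" using p(2) by (simp add: k_def)
  hence "k > 0" by (cases k) auto
  have "odd p" using assms(1) r(1) \<open>k > 0\<close> by auto
  hence "2 < p" using prime_ge_2_nat[OF p(1)] by (cases "p = 2") auto
  have "r > 0" using r(2) by (cases "r = 0") auto
  have "p > 0" using \<open>2 < p\<close> by simp
  have cop: "coprime (int p) (int r)"
    using p(1) r(2) by (simp add: prime_imp_coprime)
  obtain a where a: "Legendre a (int p) = -1"
    using exists_Legendre_minus_one[OF p(1) \<open>2 < p\<close>] by blast
  obtain b where b: "[b = a] (mod int p)" "[b = 1] (mod int r)"
    using binary_chinese_remainder_int[OF cop] by blast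
  have Lb: "Legendre b (int p) = -1"
    using Legendre_cong[OF b(1)] a by simp
  have "\<not> [b = 0] (mod int p)"
    using Lb by (auto simp: Legendre_def split: if_splits)
  hence "\<not> int p dvd b" by (simp add: cong_0_iff)
  hence "coprime (int p) b" using p(1) by (simp add: prime_imp_coprime)
  moreover have "coprime b (int r)"
    using b(2) by (metis cong_imp_coprime cong_sym coprime_1_left)
  ultimately have "coprime b (int n)"
    using r(1) by (simp add: coprime_commute)
  moreover have "Jacobi b n = -1"
  proof -
    have "Jacobi b n = Jacobi b p ^ k * Jacobi b r"
      using r(1) \<open>p > 0\<close> \<open>r > 0\<close> by (simp add: Jacobi_mult_right Jacobi_power_right)
    also have "Jacobi b r = 1"
      using Jacobi_cong[OF \<open>r > 0\<close> b(2)] by (simp add: Jacobi_one)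
    finally show ?thesis
      using Lb \<open>odd k\<close> p(1) by (simp add: Jacobi_prime)
  qed
  ultimately show ?thesis by blast
qed

lemma finite_reduced_residues [simp]: "finite (reduced_residues n)"
  by (rule finite_subset[of _ "{0..int n}"]) (auto simp: reduced_residues_def)

lemma card_reduced_residues:
  assumes "n > 1"
  shows "card (reduced_residues n) = totient n"
proof -
  have "reduced_residues n = int ` totatives n"
  proof (intro equalityI subsetI)
    fix x assume "x \<in> reduced_residues n"
    hence x: "coprime x (int n)" "1 \<le> x" "x < int n"
      by (auto simp: reduced_residues_def coprime_iff_gcd_eq_1)
    hence "nat x \<in> totatives n"
      by (auto simp: in_totatives_iff simp flip: coprime_int_iff)
    moreover have "x = int (nat x)" using x by simp
    ultimately show "x \<in> int ` totatives n" by blast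
  next
    fix x assume "x \<in> int ` totatives n"
    then obtain k where k: "x = int k" "k \<in> totatives n" by blast
    hence "k > 0" "coprime k n" "k < n"
      using totatives_less[OF k(2) assms] by (auto simp: in_totatives_iff)
    thus "x \<in> reduced_residues n"
      using k(1) by (auto simp: reduced_residues_def simp flip: coprime_iff_gcd_eq_1)
  qed
  thus ?thesis
    by (simp add: card_image totient_def)
qed

lemma mult_mod_reduced_residues:
  assumes "n > 1" "coprime b (int n)"
  shows "inj_on (\<lambda>x. b * x mod int n) (reduced_residues n)"
    and "x \<in> reduced_residues n \<Longrightarrow> b * x mod int n \<in> reduced_residues n"
proof -
  show "inj_on (\<lambda>x. b * x mod int n) (reduced_residues n)"
  proof (rule inj_onI)
    fix x y assume xy: "x \<in> reduced_residues n" "y \<in> reduced_residues n"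
      and "b * x mod int n = b * y mod int n"
    hence "[x = y] (mod int n)"
      using assms(2) cong_mult_lcancel[of b "int n" x y] by (simp add: cong_def)
    thus "x = y"
      using xy by (simp add: cong_def reduced_residues_def)
  qed
next
  assume "x \<in> reduced_residues n"
  hence "coprime (b * x) (int n)"
    using assms(2) by (simp add: reduced_residues_def coprime_iff_gcd_eq_1[symmetric])
  hence cop: "coprime (b * x mod int n) (int n)"
    using assms(1) by (simp add: coprime_iff_gcd_eq_1 gcd_mod_left)
  moreover have "b * x mod int n \<noteq> 0"
  proof
    assume "b * x mod int n = 0"
    with cop have "coprime 0 (int n)" by metis
    thus False using assms(1) by simp
  qed
  moreover have "0 \<le> b * x mod int n" "b * x mod int n < int n"
    using assms(1) by auto
  ultimately show "b * x mod int n \<in> reduced_residues n"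
    by (simp add: reduced_residues_def coprime_iff_gcd_eq_1)
qed

text \<open>
  Multiplication by an element of symbol -1 embeds each of the two sets in the other.
\<close>

lemma Jacobi_balanced:
  assumes "odd n" "\<not> is_square n"
  shows "card {x \<in> reduced_residues n. Jacobi x n = -1} =
         card {x \<in> reduced_residues n. Jacobi x n = 1}"
proof -
  have "n > 0" "n \<noteq> 1" using assms by (auto intro: odd_pos)
  hence n: "n > 1" by simp
  obtain b where b: "coprime b (int n)" "Jacobi b n = -1"
    using exists_Jacobi_minus_one[OF assms] by blast
  let ?h = "\<lambda>x. b * x mod int n"
  have J: "Jacobi (?h x) n = - Jacobi x n" for x
  proof -
    have "Jacobi (?h x) n = Jacobi (b * x) n"
      using n by (intro Jacobi_cong) auto
    thus ?thesis using Jacobi_mult[OF assms(1)] b(2) by simp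
  qed
  have le: "card {x \<in> reduced_residues n. Jacobi x n = s} \<le>
            card {x \<in> reduced_residues n. Jacobi x n = - s}" for s
  proof (rule card_inj_on_le)
    show "inj_on ?h {x \<in> reduced_residues n. Jacobi x n = s}"
      using mult_mod_reduced_residues(1)[OF n b(1)] by (rule inj_on_subset) auto
    show "?h ` {x \<in> reduced_residues n. Jacobi x n = s} \<subseteq>
          {x \<in> reduced_residues n. Jacobi x n = - s}"
      using mult_mod_reduced_residues(2)[OF n b(1)] J by auto
  qed simp
  show ?thesis
    using le[of 1] le[of "-1"] by simp
qed

section \<open>Labelings of star graphs\<close>

lemma snd_star_graph: "snd (star_graph n) = (\<lambda>v. {0, v}) ` {1..<n}"
  by (auto simp: star_graph_def)

lemma simple_graph_star:
  assumes "n > 0"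
  shows "simple_graph (star_graph n)"
proof -
  have "\<exists>a b. a < n \<and> b < n \<and> a \<noteq> b \<and> {0, v} = {a, b}" if "v \<in> {1..<n}" for v
    using assms that by (intro exI[of _ 0] exI[of _ v]) auto
  thus ?thesis
    unfolding simple_graph_def snd_star_graph by (simp add: star_graph_def)
qed

lemma connected_graph_star:
  assumes "n > 0"
  shows "connected_graph (star_graph n)"
proof -
  let ?E = "{(a, b). {a, b} \<in> snd (star_graph n)}"
  have centre: "(0, u) \<in> ?E\<^sup>*" "(u, 0) \<in> ?E\<^sup>*" if "u < n" for u
  proof -
    have "(0, u) \<in> ?E \<and> (u, 0) \<in> ?E" if "u \<noteq> 0"
    proof -
      have "{0, u} \<in> snd (star_graph n)"
        using that \<open>u < n\<close> unfolding snd_star_graph by auto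
      thus ?thesis by (simp add: insert_commute)
    qed
    thus "(0, u) \<in> ?E\<^sup>*" "(u, 0) \<in> ?E\<^sup>*"
      by (cases "u = 0"; blast)+
  qed
  have "(u, v) \<in> ?E\<^sup>*" if "u < n" "v < n" for u v
    using centre(2)[OF that(1)] centre(1)[OF that(2)] by (rule rtrancl_trans)
  moreover have "{..<n} \<noteq> {}" using assms by auto
  ultimately show ?thesis
    unfolding connected_graph_def by (simp add: star_graph_def)
qed

text \<open>
  A star has one edge per leaf, so once the centre is labelled \<open>s\<close> the counts do not depend on
  how the remaining labels are distributed over the leaves.
\<close>

lemma arithmetic_cordial_star:
  fixes A :: "int set"
  assumes struct: "arithmetic_structure \<eta> (insert s A) \<zeta> star"
    and comm: "\<And>x y. star x y = star y x"
    and A: "finite A" "s \<notin> A" "card A = n"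
    and balanced: "\<bar>int (card {x \<in> A. label_value \<eta> \<zeta> (star s x) = 0}) -
                     int (card {x \<in> A. label_value \<eta> \<zeta> (star s x) = 1})\<bar> \<le> 1"
  shows "arithmetic_cordial_graph (star_graph (n + 1)) \<eta> (insert s A) \<zeta> star"
proof -
  let ?G = "star_graph (n + 1)"
  have "card {1..n} = card A" using A by simp
  then obtain h where h: "bij_betw h {1..n} A"
    using A(1) finite_same_card_bij by blast
  define f where "f v = (if v = 0 then s else h v)" for v :: nat
  have f_leaf: "bij_betw f {1..n} A"
    using h by (rule iffD1[OF bij_betw_cong, rotated]) (auto simp: f_def)
  have "bij_betw f (insert 0 {1..n}) (insert (f 0) A)"
    using f_leaf A(2) by (intro iffD1[OF notIn_Un_bij_betw3, simplified]) (auto simp: f_def)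
  moreover have "insert 0 {1..n} = fst ?G"
    by (auto simp: star_graph_def)
  ultimately have bij: "bij_betw f (fst ?G) (insert s A)"
    by (simp add: f_def)
  \<comment> \<open>As \<open>star\<close> is commutative, any way of choosing an order of the endpoints will do.\<close>
  define g where "g e = label_value \<eta> \<zeta> (star (f (Min e)) (f (Max e)))" for e :: "nat set"
  have "induced_edge_labeling ?G \<eta> \<zeta> star f g"
    unfolding induced_edge_labeling_def g_def using comm by (auto simp: min_def max_def)
  moreover have "edge_count ?G g k = card {x \<in> A. label_value \<eta> \<zeta> (star s x) = k}" for k
  proof -
    let ?I = "{v \<in> {1..n}. label_value \<eta> \<zeta> (star s (f v)) = k}"
    have "g {0, v} = label_value \<eta> \<zeta> (star s (f v))" for v
      by (simp add: g_def f_def)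
    hence "{e \<in> snd ?G. g e = k} = (\<lambda>v. {0, v}) ` ?I"
      unfolding snd_star_graph by auto
    moreover have "inj_on (\<lambda>v. {0::nat, v}) ?I"
      by (auto simp: inj_on_def doubleton_eq_iff)
    ultimately have "edge_count ?G g k = card ?I"
      by (simp add: edge_count_def card_image)
    also have "card ?I = card (f ` ?I)"
    proof (rule card_image[symmetric])
      show "inj_on f ?I"
        using bij_betw_imp_inj_on[OF f_leaf] by (rule inj_on_subset) auto
    qed
    also have "f ` ?I = {x \<in> A. label_value \<eta> \<zeta> (star s x) = k}"
      using f_leaf by (auto simp: bij_betw_def)
    finally show ?thesis .
  qed
  ultimately have "arithmetic_cordial_labeling ?G \<eta> (insert s A) \<zeta> star f"
    using bij balanced unfolding arithmetic_cordial_labeling_def by auto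
  thus ?thesis
    using struct simple_graph_star connected_graph_star
    unfolding arithmetic_cordial_graph_def by auto
qed

section \<open>The Jacobi labeling of the star\<close>

lemma arithmetic_structure_zeta5:
  assumes "\<eta> > 0"
  shows "arithmetic_structure \<eta> S (zeta5 \<eta>) star"
proof -
  have "zeta5 \<eta> \<xi> \<in> {0, 1}" if "gcd \<xi> (int \<eta>) = 1" for \<xi>
    using Jacobi_coprime[OF assms, of \<xi>] that by (auto simp: zeta5_def coprime_iff_gcd_eq_1)
  thus ?thesis
    using assms by (simp add: arithmetic_structure_def)
qed

lemma label_value_zeta5_cong:
  assumes "\<eta> > 0" "[x = y] (mod int \<eta>)"
  shows "label_value \<eta> (zeta5 \<eta>) x = label_value \<eta> (zeta5 \<eta>) y"
  using assms cong_gcd_eq[OF assms(2)] Jacobi_cong[OF assms]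
  by (simp add: label_value_def zeta5_def)

lemma label_value_zeta5:
  assumes "\<eta> > 0" "x \<in> reduced_residues \<eta>"
  shows "label_value \<eta> (zeta5 \<eta>) x = 0 \<longleftrightarrow> Jacobi x \<eta> = -1"
    and "label_value \<eta> (zeta5 \<eta>) x = 1 \<longleftrightarrow> Jacobi x \<eta> = 1"
  using assms Jacobi_coprime[OF assms(1), of x]
  by (auto simp: label_value_def zeta5_def reduced_residues_def coprime_iff_gcd_eq_1)

text \<open>
  Translates of the reduced residues by distinct multiples of \<open>\<eta>\<close> are disjoint copies, so
  every count of a property that depends only on the class modulo \<open>\<eta>\<close> is multiplied by \<open>m\<close>.
\<close>

lemma card_translated_residues:
  assumes "\<And>x y. [x = y] (mod int \<eta>) \<Longrightarrow> P x \<longleftrightarrow> P y"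
  shows "card {x \<in> (\<Union>j\<in>{0..<m}. {i + int j * int \<eta> | i. i \<in> reduced_residues \<eta>}). P x} =
         m * card {i \<in> reduced_residues \<eta>. P i}"
proof -
  let ?t = "\<lambda>(j, i). i + int j * int \<eta>"
  let ?D = "{0..<m} \<times> {i \<in> reduced_residues \<eta>. P i}"
  have P: "P (i + int j * int \<eta>) \<longleftrightarrow> P i" for i j
    by (rule assms) (simp add: cong_def)
  have "{x \<in> (\<Union>j\<in>{0..<m}. {i + int j * int \<eta> | i. i \<in> reduced_residues \<eta>}). P x} = ?t ` ?D"
  proof (intro equalityI subsetI)
    fix x assume "x \<in> ?t ` ?D"
    thus "x \<in> {x \<in> (\<Union>j\<in>{0..<m}. {i + int j * int \<eta> | i. i \<in> reduced_residues \<eta>}). P x}"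
      using P by fastforce
  next
    fix x assume "x \<in> {x \<in> (\<Union>j\<in>{0..<m}. {i + int j * int \<eta> | i. i \<in> reduced_residues \<eta>}). P x}"
    then obtain i j where "j < m" "i \<in> reduced_residues \<eta>" "x = i + int j * int \<eta>" "P x"
      by auto
    thus "x \<in> ?t ` ?D"
      using P by (intro image_eqI[of _ _ "(j, i)"]) auto
  qed
  moreover have "inj_on ?t ?D"
  proof (rule inj_onI, clarify)
    fix j i j' i'
    assume i: "i \<in> reduced_residues \<eta>" "i' \<in> reduced_residues \<eta>"
      and eq: "i + int j * int \<eta> = i' + int j' * int \<eta>"
    have "i mod int \<eta> = i' mod int \<eta>"
      using arg_cong[OF eq, of "\<lambda>x. x mod int \<eta>"] by simp
    hence "i = i'" using i by (simp add: reduced_residues_def)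
    moreover have "\<eta> > 0" using i by (auto simp: reduced_residues_def)
    ultimately show "j = j' \<and> i = i'" using eq by simp
  qed
  ultimately show ?thesis
    by (simp add: card_image card_cartesian_product)
qed

theorem theorem3p4:
  fixes \<eta> c m :: nat and S :: "int set"
  assumes "\<eta> \<ge> 3" and "odd \<eta>" and "\<not> is_square \<eta>"
    and "c > 0" and "m > 0"
    and "S = {int c * int \<eta>} \<union> (\<Union>j\<in>{0..<m}. {i + int j * int \<eta> | i. i \<in> reduced_residues \<eta>})"
  shows "arithmetic_cordial_graph (star_graph (m * totient \<eta> + 1)) \<eta> S (zeta5 \<eta>) (+)"
proof -
  define A where "A = (\<Union>j\<in>{0..<m}. {i + int j * int \<eta> | i. i \<in> reduced_residues \<eta>})"
  let ?s = "int c * int \<eta>"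
  let ?l = "label_value \<eta> (zeta5 \<eta>)"
  have \<eta>: "\<eta> > 0" "\<eta> > 1" using assms(1) by auto
  have S: "S = insert ?s A" using assms(6) by (simp add: A_def)
  have "finite A" unfolding A_def
    by (intro finite_UN_I) (auto simp: Setcompr_eq_image)
  moreover have "?s \<notin> A"
  proof
    assume "?s \<in> A"
    then obtain i j where i: "i \<in> reduced_residues \<eta>" "?s = i + int j * int \<eta>"
      unfolding A_def by blast
    have "i mod int \<eta> = 0"
      using arg_cong[OF i(2), of "\<lambda>x. x mod int \<eta>"] by simp
    thus False using i(1) by (simp add: reduced_residues_def)
  qed
  moreover have "card A = m * totient \<eta>"
  proof -
    have "card {x \<in> A. True} = m * card {i \<in> reduced_residues \<eta>. True}"
      unfolding A_def by (rule card_translated_residues) simp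
    thus ?thesis using card_reduced_residues[OF \<eta>(2)] by simp
  qed
  moreover have "card {x \<in> A. ?l (?s + x) = k} = m * card {i \<in> reduced_residues \<eta>. ?l i = k}" for k
  proof -
    have "?l (?s + x) = ?l x" for x
      using \<eta>(1) by (intro label_value_zeta5_cong) (simp_all add: cong_def)
    thus ?thesis
      unfolding A_def using label_value_zeta5_cong[OF \<eta>(1)]
      by (subst card_translated_residues[symmetric]) auto
  qed
  moreover have "card {i \<in> reduced_residues \<eta>. ?l i = 0} = card {i \<in> reduced_residues \<eta>. ?l i = 1}"
    using Jacobi_balanced[OF assms(2,3)]
    by (simp add: label_value_zeta5[OF \<eta>(1)] cong: conj_cong)
  ultimately show ?thesis
    unfolding S
    by (intro arithmetic_cordial_star arithmetic_structure_zeta5 \<eta>(1)) simp_all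
qed

end
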